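(* Let $m\ge2$ be an integer, let $X$ be a vector space over a field $\mathbb{K}$, and let $Y_\rho$ be the modular space of a convex modular $\rho$ satisfying the $\Delta_2$-condition. Let $E$ be a non-empty subset of $X$ that is symmetric with respect to $0$ and satisfies $x+y,\ x-y\in E$ and $kx\in E$ for all $x,y\in E$ and all $k\in\mathbb{K}$. Let $f:E\to Y_\rho$ and $\varphi:E^m\to[0,\infty)$ be functions such that $$\lim_{n\to\infty}\varphi(x,nx,\dots,nx)=0\ \text{ for all }x\in E,\qquad \lim_{n\to\infty}\varphi(nx_1,nx_2,\dots,nx_m)=0\ \text{ for all }x_1,\dots,x_m\in E,$$ and $$\rho\Big(f\Big(\sum_{i=1}^m x_i\Big)+\sum_{1\le i<j\le m}f(x_i-x_j)-m\sum_{i=1}^m f(x_i)\Big)\le\varphi(x_1,x_2,\dots,x_m)\qquad\text{for all }x_1,\dots,x_m\in E .$$ Then $$f\Big(\sum_{i=1}^m x_i\Big)+\sum_{1\le i<j\le m}f(x_i-x_j)=m\sum_{i=1}^m f(x_i)\qquad\text{for all }x_1,\dots,x_m\in E .$$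
   Context: Let $Y$ be a (real or complex) vector space. A convex modular on $Y$ is a functional $\rho:Y\to[0,\infty)$ such that for all $u,v\in Y$: (1) $\rho(u)=0$ if and only if $u=0$; (2) $\rho(cu)=\rho(u)$ for every scalar $c$ with $|c|=1$; (3) $\rho(su+tv)\le s\rho(u)+t\rho(v)$ whenever $s,t\ge0$ and $s+t=1$. The associated modular space is $Y_\rho=\{u\in Y:\rho(\lambda u)\to0\text{ as }\lambda\to0\}$. The modular satisfies the $\Delta_2$-condition if there exists $\tau>0$ such that $\rho(2u)\le\tau\rho(u)$ for all $u\in Y_\rho$. Limits in $n$ are over positive integers $n$. *)

theory Defs
  imports Complex_Main "HOL-Library.FuncSet"
begin

(* A real_normed_field carries a multiplicative norm, so by the Gelfand-Mazur theorem it is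
   isometrically isomorphic to the reals or the complex numbers. Hence the scalar type 'k
   covers exactly the cases of real and of complex vector spaces; of_real embeds the
   coefficients s, t of a convex combination. *)
locale convex_modular = vector_space scale
  for scale :: "'k::real_normed_field \<Rightarrow> 'y::ab_group_add \<Rightarrow> 'y" +
  fixes \<rho> :: "'y \<Rightarrow> real"
  assumes nonneg: "\<rho> u \<ge> 0"
    and eq_0_iff: "\<rho> u = 0 \<longleftrightarrow> u = 0"
    and scale_norm_1: "norm c = 1 \<Longrightarrow> \<rho> (scale c u) = \<rho> u"
    and convex: "s \<ge> 0 \<Longrightarrow> t \<ge> 0 \<Longrightarrow> s + t = 1 \<Longrightarrow>
      \<rho> (scale (of_real s) u + scale (of_real t) v) \<le> s * \<rho> u + t * \<rho> v"

definition modular_space ::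
    "('k::real_normed_field \<Rightarrow> 'y::ab_group_add \<Rightarrow> 'y) \<Rightarrow> ('y \<Rightarrow> real) \<Rightarrow> 'y set"
  where "modular_space scale \<rho> = {u. ((\<lambda>l. \<rho> (scale l u)) \<longlongrightarrow> 0) (at 0)}"

definition delta2_condition ::
    "('k::real_normed_field \<Rightarrow> 'y::ab_group_add \<Rightarrow> 'y) \<Rightarrow> ('y \<Rightarrow> real) \<Rightarrow> bool"
  where "delta2_condition scale \<rho> \<longleftrightarrow>
    (\<exists>\<tau>>0. \<forall>u\<in>modular_space scale \<rho>. \<rho> (scale 2 u) \<le> \<tau> * \<rho> u)"

end

(* With f(0) = 0, the inequality at (x, nx, ..., nx) expresses m f(x) as the modular limit of
   f((1+(m-1)n)x) + (m-1) f((1-n)x) - m(m-1) f(nx). The difference between the two sides of the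
   equation is linear in f and commutes with dilations, so m times it at (x_1, ..., x_m) is the
   modular limit of the same combination of its values at the dilated tuples, which tends to 0.
   As \<rho> is finite and convex, the modular space is all of Y, so \<Delta>_2 makes modular limits
   compatible with sums. *)
theory Submission
  imports Defs
begin

section \<open>Convex modulars and modular convergence to zero\<close>

context convex_modular
begin

text \<open>Scalars of norm 1 do not change \<open>\<rho>\<close>, so \<open>l\<close> may be
  replaced by its norm; and \<open>norm l\<close> times \<open>u\<close> is a convex combination of
  \<open>u\<close> and 0, where \<open>\<rho>\<close> vanishes at 0.\<close>

lemma rho_scale_le:
  assumes "norm l \<le> 1"
  shows "\<rho> (scale l u) \<le> norm l * \<rho> u"
proof (cases "l = 0")
  case True
  then show ?thesis using eq_0_iff[of 0] by simp
next
  case False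
  define c where "c = l / of_real (norm l)"
  have c: "norm c = 1" and l: "l = c * of_real (norm l)"
    using False by (simp_all add: c_def norm_divide)
  have "\<rho> (scale l u) = \<rho> (scale c (scale (of_real (norm l)) u + scale (of_real (1 - norm l)) 0))"
    by (subst l) simp
  also have "\<dots> = \<rho> (scale (of_real (norm l)) u + scale (of_real (1 - norm l)) 0)"
    by (rule scale_norm_1[OF c])
  also have "\<dots> \<le> norm l * \<rho> u + (1 - norm l) * \<rho> 0"
    using assms by (intro convex) auto
  finally show ?thesis
    using eq_0_iff[of 0] by simp
qed

lemma modular_space_eq_UNIV: "modular_space scale \<rho> = UNIV"
proof -
  have "((\<lambda>l. \<rho> (scale l u)) \<longlongrightarrow> 0) (at 0)" for u
  proof (rule tendsto_sandwich[where f = "\<lambda>_. 0" and h = "\<lambda>l. norm l * \<rho> u"])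
    show "\<forall>\<^sub>F l in at 0. \<rho> (scale l u) \<le> norm l * \<rho> u"
      unfolding eventually_at by (intro exI[of _ 1]) (auto intro!: rho_scale_le)
    show "((\<lambda>l. norm l * \<rho> u) \<longlongrightarrow> 0) (at 0)"
      by (rule tendsto_eq_intros refl | simp)+
  qed (auto simp: nonneg)
  then show ?thesis by (auto simp: modular_space_def)
qed

text \<open>Modular convergence to 0. A convex modular need not satisfy the triangle inequality, so
  closure under sums is drawn from the \<Delta>_2-condition below.\<close>

definition modular_null :: "(nat \<Rightarrow> 'y) \<Rightarrow> bool"
  where "modular_null u \<longleftrightarrow> (\<lambda>n. \<rho> (u n)) \<longlonglongrightarrow> 0"

lemma modular_null_le:
  assumes "\<And>n. \<rho> (u n) \<le> b n" "b \<longlonglongrightarrow> 0"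
  shows "modular_null u"
  unfolding modular_null_def
  by (rule tendsto_sandwich[OF _ _ tendsto_const assms(2)]) (auto simp: nonneg assms(1))

lemma modular_null_const_iff: "modular_null (\<lambda>_. v) \<longleftrightarrow> v = 0"
  by (simp add: modular_null_def LIMSEQ_const_iff eq_0_iff)

lemma modular_null_minus:
  assumes "modular_null u"
  shows "modular_null (\<lambda>n. - u n)"
proof -
  have "\<rho> (- v) = \<rho> v" for v
    using scale_norm_1[of "-1" v] by simp
  with assms show ?thesis by (simp add: modular_null_def)
qed

text \<open>The sum \<open>u n + v n\<close> is the midpoint of the doubles of \<open>u n\<close>
  and \<open>v n\<close>: convexity separates the two, and \<Delta>_2 removes the factor 2 at the
  cost of a constant.\<close>

lemma modular_null_add:
  assumes \<Delta>: "delta2_condition scale \<rho>" and u: "modular_null u" and v: "modular_null v"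
  shows "modular_null (\<lambda>n. u n + v n)"
proof -
  from \<Delta> obtain \<tau> where \<tau>: "\<And>u. \<rho> (scale 2 u) \<le> \<tau> * \<rho> u"
    unfolding delta2_condition_def modular_space_eq_UNIV by blast
  show ?thesis
  proof (rule modular_null_le)
    fix n
    have half: "scale (of_real (1/2)) (scale 2 w) = w" for w
      by simp
    have "\<rho> (scale (of_real (1/2)) (scale 2 (u n)) + scale (of_real (1/2)) (scale 2 (v n)))
        \<le> 1/2 * \<rho> (scale 2 (u n)) + 1/2 * \<rho> (scale 2 (v n))"
      by (rule convex) auto
    also have "\<dots> \<le> 1/2 * (\<tau> * \<rho> (u n)) + 1/2 * (\<tau> * \<rho> (v n))"
      using \<tau>[of "u n"] \<tau>[of "v n"] by linarith
    finally show "\<rho> (u n + v n) \<le> 1/2 * (\<tau> * \<rho> (u n)) + 1/2 * (\<tau> * \<rho> (v n))"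
      by (simp only: half)
    show "(\<lambda>n. 1/2 * (\<tau> * \<rho> (u n)) + 1/2 * (\<tau> * \<rho> (v n))) \<longlonglongrightarrow> 0"
      using u v unfolding modular_null_def by (auto intro!: tendsto_eq_intros)
  qed
qed

lemma modular_null_diff:
  assumes "delta2_condition scale \<rho>" "modular_null u" "modular_null v"
  shows "modular_null (\<lambda>n. u n - v n)"
  using modular_null_add[OF assms(1,2) modular_null_minus[OF assms(3)]] by simp

lemma modular_null_sum:
  assumes "delta2_condition scale \<rho>" "\<And>i. i \<in> I \<Longrightarrow> modular_null (u i)"
  shows "modular_null (\<lambda>n. \<Sum>i\<in>I. u i n)"
  using assms(2)
proof (induction I rule: infinite_finite_induct)
  case (insert i I)
  then show ?case by (simp add: modular_null_add[OF assms(1)])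
qed (simp_all add: modular_null_const_iff)

text \<open>The coefficients that occur later are natural numbers, so iterated addition
  suffices.\<close>

lemma modular_null_scale_of_nat:
  assumes "delta2_condition scale \<rho>" "modular_null u"
  shows "modular_null (\<lambda>n. scale (of_nat k) (u n))"
proof (induction k)
  case (Suc k)
  then show ?case
    by (simp add: scale_left_distrib modular_null_add[OF assms])
qed (simp add: modular_null_const_iff)

section \<open>The defect of the functional equation, as a linear operator on functions\<close>

definition quad_defect :: "nat \<Rightarrow> ('x::ab_group_add \<Rightarrow> 'y) \<Rightarrow> (nat \<Rightarrow> 'x) \<Rightarrow> 'y"
  where "quad_defect m f x = f (\<Sum>i=1..m. x i) + (\<Sum>i=1..m. \<Sum>j\<in>{i<..m}. f (x i - x j))
    - scale (of_nat m) (\<Sum>i=1..m. f (x i))"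

lemma quad_defect_cong:
  assumes "\<And>i. i \<in> {1..m} \<Longrightarrow> x i = y i"
  shows "quad_defect m f x = quad_defect m f y"
proof -
  have "(\<Sum>i=1..m. \<Sum>j\<in>{i<..m}. f (x i - x j)) = (\<Sum>i=1..m. \<Sum>j\<in>{i<..m}. f (y i - y j))"
    by (intro sum.cong refl) (use assms in auto)
  then show ?thesis
    using assms by (simp add: quad_defect_def)
qed

lemma quad_defect_add:
  "quad_defect m (\<lambda>y. f y + g y) x = quad_defect m f x + quad_defect m g x"
  by (simp add: quad_defect_def sum.distrib scale_right_distrib algebra_simps)

lemma quad_defect_diff:
  "quad_defect m (\<lambda>y. f y - g y) x = quad_defect m f x - quad_defect m g x"
  by (simp add: quad_defect_def sum_subtractf scale_right_diff_distrib algebra_simps)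

lemma quad_defect_scale:
  "quad_defect m (\<lambda>y. scale c (f y)) x = scale c (quad_defect m f x)"
  by (simp add: quad_defect_def scale_sum_right scale_right_distrib scale_right_diff_distrib
      mult.commute)

text \<open>An additive map passes through the sums and differences inside \<open>f\<close>. This is
  applied to dilations by a scalar, moving them from the function to the tuple.\<close>

lemma quad_defect_comp:
  assumes "Modules.additive h"
  shows "quad_defect m (\<lambda>y. f (h y)) x = quad_defect m f (\<lambda>i. h (x i))"
  by (simp add: quad_defect_def additive.sum[OF assms] additive.diff[OF assms])

text \<open>The defect is a finite combination of values of \<open>F n\<close> at points that do not
  depend on \<open>n\<close>. These points lie in \<open>E\<close>, since sums and differences of
  the \<open>x i\<close> do; \<open>0 \<in> E\<close> covers the empty sum in the induction.\<close>

lemma modular_null_quad_defect: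
  assumes \<Delta>: "delta2_condition scale \<rho>"
    and "\<And>y. y \<in> E \<Longrightarrow> modular_null (\<lambda>n. F n y)"
    and "0 \<in> E" "\<And>x y. x \<in> E \<Longrightarrow> y \<in> E \<Longrightarrow> x + y \<in> E"
    and "\<And>x y. x \<in> E \<Longrightarrow> y \<in> E \<Longrightarrow> x - y \<in> E"
    and x: "\<And>i. i \<in> {1..m} \<Longrightarrow> x i \<in> E"
  shows "modular_null (\<lambda>n. quad_defect m (F n) x)"
proof -
  have "(\<Sum>i\<in>I. x i) \<in> E" if "I \<subseteq> {1..m}" for I
    using that by (induction I rule: infinite_finite_induct) (use assms in auto)
  then show ?thesis
    unfolding quad_defect_def
    by (intro modular_null_diff[OF \<Delta>] modular_null_add[OF \<Delta>] modular_null_sum[OF \<Delta>]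
        modular_null_scale_of_nat[OF \<Delta>] assms x) auto
qed

text \<open>At the zero tuple the defect is (1 + S - m^2) f(0), with S the number of pairs i < j.
  The crude bound S <= m(m - 1) gives 1 + S < S + m <= m^2, and the scalars have characteristic
  0.\<close>

lemma quad_defect_zero_imp:
  assumes "m \<ge> 2" "quad_defect m f (\<lambda>_. 0) = 0"
  shows "f 0 = 0"
proof -
  define S where "S = (\<Sum>i=1..m. m - i)"
  have "S \<le> (\<Sum>i=1..m. m - 1)"
    unfolding S_def by (intro sum_mono) auto
  then have "S + m \<le> m * m"
    using assms(1) by (cases m) auto
  with assms(1) have "1 + S \<noteq> m * m" by linarith
  then have ne: "(1 + of_nat S :: 'k) \<noteq> of_nat (m * m)"
    by (metis of_nat_1 of_nat_add of_nat_eq_iff)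
  have sc: "(\<Sum>i\<in>I. v) = scale (of_nat (card I)) v" for v and I :: "nat set"
    using scale_sum_left[of "\<lambda>_. 1" I v] by simp
  have "(\<Sum>i=1..m. \<Sum>j\<in>{i<..m}. f 0) = scale (of_nat S) (f 0)"
    by (simp add: sc scale_sum_left S_def)
  then have "scale (1 + of_nat S - of_nat (m * m)) (f 0) = 0"
    using assms(2)
    by (simp add: quad_defect_def sc scale_left_distrib scale_left_diff_distrib)
  with ne show ?thesis by simp
qed

text \<open>Only the m - 1 pairs (1, j) contribute \<open>f (a - b)\<close>; every other pair
  compares \<open>b\<close> with itself and contributes \<open>f 0 = 0\<close>.\<close>

lemma quad_defect_first:
  assumes "m \<ge> 2" "f 0 = 0"
  shows "quad_defect m f (\<lambda>i. if i = 1 then a else b)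
    = f (a + (\<Sum>i=2..m. b)) + scale (of_nat (m - 1)) (f (a - b))
      - scale (of_nat m) (f a + scale (of_nat (m - 1)) (f b))"
proof -
  have sc: "(\<Sum>i\<in>I. v) = scale (of_nat (card I)) v" for v and I :: "nat set"
    using scale_sum_left[of "\<lambda>_. 1" I v] by simp
  let ?x = "\<lambda>i::nat. if i = 1 then a else b"
  have split1: "(\<Sum>i=1..m. F i) = F 1 + (\<Sum>i=2..m. F i)" for F :: "nat \<Rightarrow> 'z::comm_monoid_add"
    using assms(1) by (simp add: sum.atLeast_Suc_atMost numeral_2_eq_2)
  have "(\<Sum>i=1..m. ?x i) = a + (\<Sum>i=2..m. b)"
    unfolding split1 by (intro arg_cong2[where f = "(+)"] sum.cong) auto
  moreover have "(\<Sum>i=1..m. f (?x i)) = f a + (\<Sum>i=2..m. f b)"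
    unfolding split1 by (intro arg_cong2[where f = "(+)"] sum.cong) auto
  moreover have "(\<Sum>i=1..m. \<Sum>j\<in>{i<..m}. f (?x i - ?x j)) = (\<Sum>j\<in>{1<..m}. f (a - b)) + 0"
    unfolding split1
    by (intro arg_cong2[where f = "(+)"] sum.cong sum.neutral ballI) (auto simp: assms(2))
  ultimately show ?thesis
    by (simp only: quad_defect_def sc) simp
qed

end

theorem theorem3:
  fixes m :: nat
    and scaleX :: "'a::field \<Rightarrow> 'x::ab_group_add \<Rightarrow> 'x"
    and scaleY :: "'k::real_normed_field \<Rightarrow> 'y::ab_group_add \<Rightarrow> 'y"
    and \<rho> :: "'y \<Rightarrow> real"
    and E :: "'x set"
    and f :: "'x \<Rightarrow> 'y"
    and \<phi> :: "(nat \<Rightarrow> 'x) \<Rightarrow> real"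
  assumes "m \<ge> 2"
    and "vector_space scaleX"
    and "convex_modular scaleY \<rho>"
    and "delta2_condition scaleY \<rho>"
    and "E \<noteq> {}"
    and "\<And>x. x \<in> E \<Longrightarrow> - x \<in> E"
    and "\<And>x y. x \<in> E \<Longrightarrow> y \<in> E \<Longrightarrow> x + y \<in> E"
    and "\<And>x y. x \<in> E \<Longrightarrow> y \<in> E \<Longrightarrow> x - y \<in> E"
    and "\<And>k x. x \<in> E \<Longrightarrow> scaleX k x \<in> E"
    and "f \<in> E \<rightarrow> modular_space scaleY \<rho>"
    and "\<phi> \<in> ({1..m} \<rightarrow>\<^sub>E E) \<rightarrow> {0..}"
    and "\<And>x. x \<in> E \<Longrightarrow>
      (\<lambda>n. \<phi> (\<lambda>i\<in>{1..m}. if i = 1 then x else scaleX (of_nat n) x)) \<longlonglongrightarrow> 0"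
    and "\<And>x. x \<in> {1..m} \<rightarrow>\<^sub>E E \<Longrightarrow>
      (\<lambda>n. \<phi> (\<lambda>i\<in>{1..m}. scaleX (of_nat n) (x i))) \<longlonglongrightarrow> 0"
    and "\<And>x. x \<in> {1..m} \<rightarrow>\<^sub>E E \<Longrightarrow>
      \<rho> (f (\<Sum>i=1..m. x i) + (\<Sum>i=1..m. \<Sum>j\<in>{i<..m}. f (x i - x j))
          - scaleY (of_nat m) (\<Sum>i=1..m. f (x i))) \<le> \<phi> x"
  shows "\<forall>x \<in> {1..m} \<rightarrow>\<^sub>E E.
      f (\<Sum>i=1..m. x i) + (\<Sum>i=1..m. \<Sum>j\<in>{i<..m}. f (x i - x j))
        = scaleY (of_nat m) (\<Sum>i=1..m. f (x i))"
proof -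
  interpret X: vector_space scaleX by fact
  interpret Y: convex_modular scaleY \<rho> by fact
  note \<Delta> = assms(4)
  note E_minus = assms(6) and E_add = assms(7) and E_diff = assms(8) and E_scale = assms(9)
  let ?D = "Y.quad_defect m"
  have E0: "0 \<in> E" using assms(5) E_diff by (metis all_not_in_conv diff_self)
  have add_scale: "Modules.additive (scaleX c)" for c
    by unfold_locales (simp add: X.scale_right_distrib)
  \<comment> \<open>The hypotheses speak of extensional tuples. The defect reads only the entries 1
    to m, so restricting the tuple leaves it unchanged.\<close>
  have defect: "\<rho> (?D f x) \<le> \<phi> (restrict x {1..m})"
    if "\<And>i. i \<in> {1..m} \<Longrightarrow> x i \<in> E" for x
  proof -
    have "restrict x {1..m} \<in> {1..m} \<rightarrow>\<^sub>E E" using that by auto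
    from assms(14)[OF this]
    have "\<rho> (?D f (restrict x {1..m})) \<le> \<phi> (restrict x {1..m})"
      by (simp only: Y.quad_defect_def)
    also have "?D f (restrict x {1..m}) = ?D f x"
      by (rule Y.quad_defect_cong) simp
    finally show ?thesis .
  qed
  have dil: "Y.modular_null (\<lambda>n. ?D f (\<lambda>i. scaleX (of_nat n) (x i)))"
    if "\<And>i. i \<in> {1..m} \<Longrightarrow> x i \<in> E" for x
  proof (rule Y.modular_null_le)
    show "\<rho> (?D f (\<lambda>i. scaleX (of_nat n) (x i))) \<le> \<phi> (\<lambda>i\<in>{1..m}. scaleX (of_nat n) (x i))" for n
      by (rule defect) (use that E_scale in auto)
    have "(\<lambda>i\<in>{1..m}. scaleX (of_nat n) (restrict x {1..m} i))
        = (\<lambda>i\<in>{1..m}. scaleX (of_nat n) (x i))" for n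
      by (auto simp: restrict_def)
    with assms(13)[of "restrict x {1..m}"] that
    show "(\<lambda>n. \<phi> (\<lambda>i\<in>{1..m}. scaleX (of_nat n) (x i))) \<longlonglongrightarrow> 0"
      by auto
  qed
  \<comment> \<open>Dilations fix the zero tuple, so this null sequence is constant and its value
    must be 0.\<close>
  have "Y.modular_null (\<lambda>n. ?D f (\<lambda>i. 0))"
    using dil[of "\<lambda>_. 0"] E0 by simp
  then have "?D f (\<lambda>_. 0) = 0"
    by (simp add: Y.modular_null_const_iff)
  then have f0: "f 0 = 0"
    by (rule Y.quad_defect_zero_imp[OF assms(1)])

  \<comment> \<open>Indexed by \<open>Suc n\<close>, so that \<open>(1 - Suc n) x\<close> is the natural multiple \<open>n (- x)\<close>.\<close>
  define g where "g n y = f (scaleX (of_nat (m + (m - 1) * n)) y)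
      + scaleY (of_nat (m - 1)) (f (scaleX (- of_nat n) y))
      - scaleY (of_nat (m * (m - 1))) (f (scaleX (of_nat (Suc n)) y))
      - scaleY (of_nat m) (f y)" for n y
  \<comment> \<open>\<open>g n y\<close> is the defect of \<open>f\<close> at the tuple (y, (n+1)y,
    ..., (n+1)y), which the first limit hypothesis on \<open>\<phi>\<close> makes small.\<close>
  have g_null: "Y.modular_null (\<lambda>n. g n y)" if y: "y \<in> E" for y
  proof (rule Y.modular_null_le)
    let ?b = "\<lambda>n. \<phi> (\<lambda>i\<in>{1..m}. if i = 1 then y else scaleX (of_nat n) y)"
    show "(\<lambda>n. ?b (Suc n)) \<longlonglongrightarrow> 0"
      using assms(12)[OF y] by (rule LIMSEQ_Suc)
    fix n
    have "(\<Sum>i=2..m. scaleX (of_nat (Suc n)) y) = scaleX (of_nat (\<Sum>i=2..m. Suc n)) y"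
      by (simp only: X.scale_sum_left of_nat_sum)
    also have "y + \<dots> = scaleX (of_nat (1 + (\<Sum>i=2..m. Suc n))) y"
      by (simp only: of_nat_add of_nat_1 X.scale_left_distrib X.scale_one)
    \<comment> \<open>The leading coefficient in \<open>g\<close>: 1 + (m - 1)(n + 1).\<close>
    also have "1 + (\<Sum>i=2..m. Suc n) = m + (m - 1) * n"
      using assms(1) by (simp add: numeral_2_eq_2)
    finally have 1: "y + (\<Sum>i=2..m. scaleX (of_nat (Suc n)) y)
        = scaleX (of_nat (m + (m - 1) * n)) y" .
    have 2: "y - scaleX (of_nat (Suc n)) y = scaleX (- of_nat n) y"
      by (simp only: of_nat_Suc X.scale_left_distrib X.scale_one X.scale_minus_left) simp
    have "g n y = ?D f (\<lambda>i. if i = 1 then y else scaleX (of_nat (Suc n)) y)"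
      unfolding Y.quad_defect_first[where f = f, OF assms(1) f0] 1 2 g_def
      by (simp only: Y.scale_right_distrib Y.scale_scale of_nat_mult diff_diff_eq add.commute)
    also have "\<rho> \<dots> \<le> ?b (Suc n)"
      by (rule defect) (use y E_scale in auto)
    finally show "\<rho> (g n y) \<le> ?b (Suc n)" .
  qed

  have cancel: "u - (u - v) = v" for u v :: 'y by simp
  show ?thesis
  proof
    fix x assume "x \<in> {1..m} \<rightarrow>\<^sub>E E"
    then have x: "\<And>i. i \<in> {1..m} \<Longrightarrow> x i \<in> E" by auto
    note comp = Y.quad_defect_comp[OF add_scale, of m f]
    \<comment> \<open>A subsequence of the dilations by n, strictly increasing because m >=
      2.\<close>
    have A: "Y.modular_null (\<lambda>n. ?D f (\<lambda>i. scaleX (of_nat (m + (m - 1) * n)) (x i)))"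
    proof -
      have "strict_mono (\<lambda>n. m + (m - 1) * n)"
        using assms(1) by (auto simp: strict_mono_def)
      from LIMSEQ_subseq_LIMSEQ[OF dil[OF x, unfolded Y.modular_null_def] this]
      show ?thesis by (simp add: Y.modular_null_def o_def)
    qed
    \<comment> \<open>Negative multiples of \<open>x i\<close> are natural multiples of
      \<open>- x i\<close>, which is in \<open>E\<close> by symmetry.\<close>
    have B: "Y.modular_null (\<lambda>n. ?D f (\<lambda>i. scaleX (- of_nat n) (x i)))"
      using dil[of "\<lambda>i. - x i"] x E_minus by simp
    have C: "Y.modular_null (\<lambda>n. ?D f (\<lambda>i. scaleX (of_nat (Suc n)) (x i)))"
      using LIMSEQ_Suc[OF dil[OF x, unfolded Y.modular_null_def]]
      by (simp only: Y.modular_null_def)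
    have G: "Y.modular_null (\<lambda>n. ?D (g n) x)"
      by (rule Y.modular_null_quad_defect[OF \<Delta> g_null E0 E_add E_diff x])
    \<comment> \<open>By linearity \<open>?D (g n) x\<close> is the displayed combination of the
      three dilated defects minus m times \<open>?D f x\<close>. Subtracting it cancels everything
      that depends on n and leaves a constant sequence.\<close>
    have "Y.modular_null (\<lambda>n. ?D f (\<lambda>i. scaleX (of_nat (m + (m - 1) * n)) (x i))
        + scaleY (of_nat (m - 1)) (?D f (\<lambda>i. scaleX (- of_nat n) (x i)))
        - scaleY (of_nat (m * (m - 1))) (?D f (\<lambda>i. scaleX (of_nat (Suc n)) (x i)))
        - ?D (g n) x)" (is "Y.modular_null ?h")
      by (intro Y.modular_null_diff[OF \<Delta>] Y.modular_null_add[OF \<Delta>]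
          Y.modular_null_scale_of_nat[OF \<Delta>] A B C G)
    also have "?h = (\<lambda>n. scaleY (of_nat m) (?D f x))"
      unfolding g_def Y.quad_defect_add Y.quad_defect_diff Y.quad_defect_scale comp
      by (intro ext) (rule cancel)
    finally have "Y.modular_null (\<lambda>n. scaleY (of_nat m) (?D f x))" .
    \<comment> \<open>A constant null sequence is 0, and m is invertible in the scalar
      field.\<close>
    then have "?D f x = 0"
      using assms(1) by (simp add: Y.modular_null_const_iff)
    then show "f (\<Sum>i=1..m. x i) + (\<Sum>i=1..m. \<Sum>j\<in>{i<..m}. f (x i - x j))
        = scaleY (of_nat m) (\<Sum>i=1..m. f (x i))"
      by (simp add: Y.quad_defect_def)
  qed
qed

end
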